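(* Let $Z_1\sim F_1,\dots,Z_n\sim F_n,Z_{n+1}\sim G$ be independent, where $Z_i=(X_i,Y_i)$, and let $\bar F=\frac1n\sum_{i=1}^nF_i$. Fix $\alpha\in[0,1]$ and a weight function $w:\mathcal{X}\times\mathcal{Y}\to(0,\infty)$ with $\mathbb{E}_{\bar F}[w(X,Y)]<\infty$. Then the weighted conformal prediction set $$\mathcal{C}(X_{n+1})=\bigg\{y\in\mathcal{Y}:S^y_{n+1}\le\mathrm{Quantile}_{1-\alpha}\bigg(\frac{\sum_{i=1}^n w(Z_i)\,\delta_{S^y_i}+w(X_{n+1},y)\,\delta_{S^y_{n+1}}}{\sum_{i=1}^nw(Z_i)+w(X_{n+1},y)}\bigg)\bigg\}$$ satisfies $$\mathbb{P}\{Y_{n+1}\in\mathcal{C}(X_{n+1})\}\ge1-\alpha-\frac1n\sum_{i=1}^n\Big\{\mathbb{E}_{F_i}\big[(w^*_i(X,Y)-\bar w(X,Y))_+\big]+d_{TV}(F_i,\bar F)\Big\},$$ where $w_i^*(x,y)=\frac{\mathrm{d}G}{\mathrm{d}F_i}(x,y)$ for $i=1,\dots,n$, and $\bar w(x,y)=w(x,y)/\mathbb{E}_{\bar F}[w(X,Y)]$.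
   Context: $\mathcal{X},\mathcal{Y}$ are measurable spaces, $\mathcal{Z}=\mathcal{X}\times\mathcal{Y}$, $n\ge1$, and all functions are measurable. $F_1,\dots,F_n,G$ are distributions on $\mathcal{Z}$ such that each density $w_i^*=\mathrm{d}G/\mathrm{d}F_i$ exists. $\mathbb{E}_P$ is the expectation over $(X,Y)\sim P$; $(t)_+=\max\{t,0\}$; $\delta_v$ is the point mass at $v$; $d_{TV}(P,Q)=\sup_A\{P(A)-Q(A)\}$ is the total variation distance; $\mathrm{Quantile}_\tau(P)=\inf\{x\in\mathbb{R}:\mathbb{P}_{V\sim P}\{V\le x\}\ge\tau\}$. A score function $\mathsf{s}((x,y),\mathrm{bag}(z))\in\mathbb{R}$ is fixed; it assigns a real value to a point $(x,y)\in\mathcal{Z}$ given the unordered multiset $\mathrm{bag}(z)$ of the entries of a dataset $z\in\mathcal{Z}^{n+1}$ (so it is invariant to permutations of $z$). For $y\in\mathcal{Y}$, let $Z^y=(Z_1,\dots,Z_n,(X_{n+1},y))$ with $i$th entry $Z^y_i$, and $S^y_i=\mathsf{s}(Z^y_i,\mathrm{bag}(Z^y))$, $i=1,\dots,n+1$. *)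

theory Defs
  imports "HOL-Probability.Probability"
begin

text \<open>The measure \<open>\<Sum>i\<in>I. c i \<cdot> P i\<close> on the measurable space underlying \<open>N\<close>, for finite \<open>I\<close>,
  nonnegative weights \<open>c\<close> and measures \<open>P i\<close> on the same measurable space as \<open>N\<close>.\<close>

definition mixture :: "'a measure \<Rightarrow> 'i set \<Rightarrow> ('i \<Rightarrow> real) \<Rightarrow> ('i \<Rightarrow> 'a measure) \<Rightarrow> 'a measure" where
  "mixture N I c P =
     measure_of (space N) (sets N) (\<lambda>A. \<Sum>i\<in>I. ennreal (c i) * emeasure (P i) A)"

lemma sets_mixture [simp, measurable_cong]: "sets (mixture N I c P) = sets N"
  by (simp add: mixture_def)

lemma space_mixture [simp]: "space (mixture N I c P) = space N"
  by (simp add: mixture_def)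

lemma emeasure_mixture:
  assumes "\<And>i. i \<in> I \<Longrightarrow> sets (P i) = sets N" and A: "A \<in> sets N"
  shows "emeasure (mixture N I c P) A = (\<Sum>i\<in>I. ennreal (c i) * emeasure (P i) A)"
proof (rule emeasure_measure_of[OF mixture_def])
  show "sets N \<subseteq> Pow (space N)" by (rule sets.space_closed)
  show "positive (sets (mixture N I c P)) (\<lambda>A. \<Sum>i\<in>I. ennreal (c i) * emeasure (P i) A)"
    by (simp add: positive_def)
  show "countably_additive (sets (mixture N I c P)) (\<lambda>A. \<Sum>i\<in>I. ennreal (c i) * emeasure (P i) A)"
  proof (rule countably_additiveI)
    fix B :: "nat \<Rightarrow> _"
    assume B: "range B \<subseteq> sets (mixture N I c P)" "disjoint_family B"
    have "(\<Sum>k. emeasure (P i) (B k)) = emeasure (P i) (\<Union>k. B k)" if "i \<in> I" for i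
      using B assms(1)[OF that] by (intro suminf_emeasure) auto
    then show "(\<Sum>k. \<Sum>i\<in>I. ennreal (c i) * emeasure (P i) (B k))
        = (\<Sum>i\<in>I. ennreal (c i) * emeasure (P i) (\<Union>k. B k))"
      by (subst suminf_sum) auto
  qed
  show "A \<in> sets (mixture N I c P)" using A by simp
qed

text \<open>For probability measures \<open>P\<close> and \<open>Q\<close> on the same measurable space.\<close>

definition tv_dist :: "'a measure \<Rightarrow> 'a measure \<Rightarrow> real" where
  "tv_dist P Q = (SUP A\<in>sets P. measure P A - measure Q A)"

text \<open>The infimum is taken in the extended reals: for \<open>\<tau> = 0\<close> it ranges over all reals and the
  quantile is \<open>-\<infinity>\<close>.\<close>

definition quantile :: "real \<Rightarrow> real measure \<Rightarrow> ereal" where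
  "quantile \<tau> P = (INF x\<in>{x. cdf P x \<ge> \<tau>}. ereal x)"

text \<open>A dataset with \<open>n + 1\<close> entries is a function \<open>z\<close> of which only the values on \<open>{1..n+1}\<close>
  matter.\<close>

definition bag :: "nat \<Rightarrow> (nat \<Rightarrow> 'z) \<Rightarrow> 'z multiset" where
  "bag n z = image_mset z (mset_set {1..n+1})"

definition score :: "nat \<Rightarrow> ('z \<Rightarrow> 'z multiset \<Rightarrow> real) \<Rightarrow> (nat \<Rightarrow> 'z) \<Rightarrow> nat \<Rightarrow> real" where
  "score n s z i = s (z i) (bag n z)"

definition weighted_score_dist ::
  "nat \<Rightarrow> ('z \<Rightarrow> 'z multiset \<Rightarrow> real) \<Rightarrow> ('z \<Rightarrow> real) \<Rightarrow> (nat \<Rightarrow> 'z) \<Rightarrow> real measure" where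
  "weighted_score_dist n s w z =
     mixture borel {1..n+1} (\<lambda>i. w (z i) / (\<Sum>j=1..n+1. w (z j)))
       (\<lambda>i. return borel (score n s z i))"

text \<open>The prediction set at the test covariate \<open>x\<close> given the training data \<open>z 1, \<dots>, z n\<close>; the
  value \<open>z (n + 1)\<close> is overwritten by the candidate point \<open>(x, y)\<close>.\<close>

definition wcp_set ::
  "'y measure \<Rightarrow> nat \<Rightarrow> ('x \<times> 'y \<Rightarrow> ('x \<times> 'y) multiset \<Rightarrow> real) \<Rightarrow> ('x \<times> 'y \<Rightarrow> real) \<Rightarrow> real \<Rightarrow>
     (nat \<Rightarrow> 'x \<times> 'y) \<Rightarrow> 'x \<Rightarrow> 'y set" where
  "wcp_set MY n s w \<alpha> z x =
     {y \<in> space MY. let zy = z(n+1 := (x, y)) in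
        ereal (score n s zy (n+1)) \<le> quantile (1 - \<alpha>) (weighted_score_dist n s w zy)}"

end

theory Submission imports Defs
begin

text \<open>
  Write \<open>e\<^sub>k(z)\<close> for the indicator that the \<open>k\<close>th point of the dataset \<open>z\<close> has a score above the
  weighted quantile of all \<open>n + 1\<close> scores. Two facts about \<open>e\<close> matter. It depends on \<open>z\<close> only
  through the point \<open>z\<^sub>k\<close> and the bag of \<open>z\<close>, hence is equivariant under permutations; and for each
  fixed \<open>z\<close> the points with \<open>e\<^sub>k(z) = 1\<close> carry at most the fraction \<open>\<alpha>\<close> of the total weight
  (\<open>score_le_quantile_iff\<close>, \<open>sum_uncovered_le\<close>).

  Let \<open>H(Q) = F\<^sub>1 \<times> \<dots> \<times> F\<^sub>n \<times> Q\<close> be the law of the data when the test point has law \<open>Q\<close>, and let \<open>v\<close>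
  be the weight normalised so that its integral with respect to the average law \<open>F\<^sub>a\<^sub>v\<close> is 1. The
  noncoverage probability is \<open>p = E\<^bsub>H(G)\<^esub>[e\<^sub>n\<^sub>+\<^sub>1]\<close>. Let \<open>r\<^sub>i\<close> be the density of \<open>G\<close> with respect to
  \<open>F\<^sub>i\<close>, let \<open>m\<^sub>i = min(r\<^sub>i, v)\<close>, let \<open>D\<close> be the mean over \<open>i\<close> of \<open>E\<^bsub>F i\<^esub>[(r\<^sub>i - v)\<^sub>+]\<close> and let \<open>T\<close> be
  the mean of the total variation distances between \<open>F\<^sub>i\<close> and \<open>F\<^sub>a\<^sub>v\<close>. Since \<open>r\<^sub>i = (r\<^sub>i - v)\<^sub>+ + m\<^sub>i\<close>, for every \<open>i\<close>

    \<open>p \<le> E\<^bsub>F i\<^esub>[(r\<^sub>i - v)\<^sub>+] + E\<^bsub>H(F i)\<^esub>[m\<^sub>i(z\<^sub>n\<^sub>+\<^sub>1) e\<^sub>n\<^sub>+\<^sub>1]\<close>.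

  The last expectation is estimated in two ways.

  Replacement: \<open>m\<^sub>i \<le> v\<close>, and the average of \<open>H(F\<^sub>i)\<close> over \<open>i\<close> is \<open>H(F\<^sub>a\<^sub>v)\<close>. So \<open>p \<le> D + A\<close> with
  \<open>A = E\<^bsub>H(F av)\<^esub>[v(z\<^sub>n\<^sub>+\<^sub>1) e\<^sub>n\<^sub>+\<^sub>1]\<close>.

  Exchange: under \<open>H(F\<^sub>i)\<close> the coordinates \<open>i\<close> and \<open>n + 1\<close> may be swapped, which turns the expectation
  into \<open>E\<^bsub>H(F i)\<^esub>[m\<^sub>i(z\<^sub>i) e\<^sub>i]\<close>. As a function of the test point alone the integrand has mean at most
  \<open>E\<^bsub>F i\<^esub>[m\<^sub>i] \<le> E\<^bsub>F i\<^esub>[r\<^sub>i] = 1\<close>, so that passing from \<open>H(F\<^sub>i)\<close> to \<open>H(F\<^sub>a\<^sub>v)\<close> costs one total variation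
  distance with constant 1. Only here is the truncation \<open>m\<^sub>i\<close> essential: with \<open>v\<close> in place of \<open>m\<^sub>i\<close>
  the constant would be \<open>E\<^bsub>F i\<^esub>[v]\<close>, which need not be at most 1. Afterwards \<open>m\<^sub>i \<le> v\<close> gives
  \<open>p \<le> D + T + b/n\<close> with \<open>b = \<Sum>\<^sub>i\<^sub>\<le>\<^sub>n E\<^bsub>H(F av)\<^esub>[v(z\<^sub>i) e\<^sub>i]\<close>.

  Neither \<open>A\<close> nor \<open>b/n\<close> is at most \<open>\<alpha>\<close> in general, but \<open>A + b \<le> \<alpha> (n + 1)\<close> by the bound for fixed
  datasets. Adding the first estimate to \<open>n\<close> times the second gives
  \<open>(n + 1) p \<le> (n + 1) (D + \<alpha>) + n T\<close>, which is slightly more than the claim. The estimate is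
  \<open>weighted_rejection_bound\<close>.
\<close>

section \<open>Mixtures and total variation\<close>

lemma nn_integral_mixture:
  assumes P: "\<And>i. i \<in> I \<Longrightarrow> sets (P i) = sets N"
    and f: "f \<in> borel_measurable N"
  shows "(\<integral>\<^sup>+x. f x \<partial>mixture N I c P) = (\<Sum>i\<in>I. ennreal (c i) * (\<integral>\<^sup>+x. f x \<partial>P i))"
  using f
proof (induction rule: borel_measurable_induct)
  case (cong f g)
  have "(\<integral>\<^sup>+x. f x \<partial>mixture N I c P) = (\<integral>\<^sup>+x. g x \<partial>mixture N I c P)"
    using cong by (intro nn_integral_cong) simp
  moreover have "(\<integral>\<^sup>+x. f x \<partial>P i) = (\<integral>\<^sup>+x. g x \<partial>P i)" if "i \<in> I" for i
    using cong sets_eq_imp_space_eq[OF P[OF that]] by (intro nn_integral_cong) simp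
  ultimately show ?case using cong by simp
next
  case (set A)
  then show ?case using P by (simp add: emeasure_mixture)
next
  case (mult u a)
  have "(\<integral>\<^sup>+x. a * u x \<partial>P i) = a * (\<integral>\<^sup>+x. u x \<partial>P i)" if "i \<in> I" for i
    using mult by (intro nn_integral_cmult) (simp add: measurable_cong_sets[OF P[OF that] refl])
  moreover have "(\<integral>\<^sup>+x. a * u x \<partial>mixture N I c P) = a * (\<integral>\<^sup>+x. u x \<partial>mixture N I c P)"
    using mult by (intro nn_integral_cmult) (simp add: measurable_cong_sets[OF sets_mixture refl])
  ultimately show ?case using mult by (simp add: sum_distrib_left mult.left_commute)
next
  case (add u v)
  have "(\<integral>\<^sup>+x. v x + u x \<partial>P i) = (\<integral>\<^sup>+x. v x \<partial>P i) + (\<integral>\<^sup>+x. u x \<partial>P i)" if "i \<in> I" for i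
    using add by (intro nn_integral_add) (simp_all add: measurable_cong_sets[OF P[OF that] refl])
  moreover have "(\<integral>\<^sup>+x. v x + u x \<partial>mixture N I c P)
      = (\<integral>\<^sup>+x. v x \<partial>mixture N I c P) + (\<integral>\<^sup>+x. u x \<partial>mixture N I c P)"
    using add by (intro nn_integral_add) (simp_all add: measurable_cong_sets[OF sets_mixture refl])
  ultimately show ?case using add by (simp add: sum.distrib distrib_left)
next
  case (seq U)
  have "(\<integral>\<^sup>+x. (SUP k. U k x) \<partial>P i) = (SUP k. \<integral>\<^sup>+x. U k x \<partial>P i)" if "i \<in> I" for i
    using seq by (intro nn_integral_monotone_convergence_SUP)
      (simp_all add: measurable_cong_sets[OF P[OF that] refl])
  moreover have "(\<integral>\<^sup>+x. (SUP k. U k x) \<partial>mixture N I c P) = (SUP k. \<integral>\<^sup>+x. U k x \<partial>mixture N I c P)"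
    using seq by (intro nn_integral_monotone_convergence_SUP)
      (simp_all add: measurable_cong_sets[OF sets_mixture refl])
  moreover have "(SUP k. \<Sum>i\<in>I. ennreal (c i) * (\<integral>\<^sup>+x. U k x \<partial>P i))
      = (\<Sum>i\<in>I. SUP k. ennreal (c i) * (\<integral>\<^sup>+x. U k x \<partial>P i))"
    using seq(3) by (intro ennreal_SUP_sum)
      (auto simp: incseq_def le_fun_def intro!: mult_left_mono nn_integral_mono)
  ultimately show ?case using seq by (simp add: image_comp SUP_mult_left_ennreal)
qed

lemma
  assumes "prob_space P" "prob_space Q"
  shows tv_dist_nonneg: "0 \<le> tv_dist P Q"
    and measure_diff_le_tv_dist: "A \<in> sets P \<Longrightarrow> measure P A - measure Q A \<le> tv_dist P Q"
proof -
  interpret P: prob_space P by fact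
  interpret Q: prob_space Q by fact
  have bdd: "bdd_above ((\<lambda>A. measure P A - measure Q A) ` sets P)"
    using P.prob_le_1 by (intro bdd_aboveI2[where M=1])
      (metis add.right_neutral add_mono diff_le_eq measure_nonneg)
  show le: "measure P A - measure Q A \<le> tv_dist P Q" if "A \<in> sets P" for A
    unfolding tv_dist_def using that bdd by (rule cSUP_upper)
  show "0 \<le> tv_dist P Q" using le[of "{}"] by simp
qed

text \<open>By Fubini, since \<open>g x\<close> is the length of \<open>{t. 0 \<le> t < g x}\<close>. The bound \<open>g \<le> 1\<close> confines the
  levels to the unit interval, so that an error that is uniform in the level stays bounded after
  integration.\<close>

lemma nn_integral_layer_cake_unit:
  fixes g :: "'a \<Rightarrow> ennreal"
  assumes "sigma_finite_measure M"
    and [measurable]: "g \<in> borel_measurable M" and le: "\<And>x. x \<in> space M \<Longrightarrow> g x \<le> 1"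
  shows "(\<integral>\<^sup>+x. g x \<partial>M)
    = (\<integral>\<^sup>+t. emeasure M {x \<in> space M. ennreal t < g x} * indicator {0..1} t \<partial>lborel)"
proof -
  interpret sigma_finite_measure M by fact
  interpret pair_sigma_finite M lborel by unfold_locales
  have "(\<integral>\<^sup>+t. emeasure M {x \<in> space M. ennreal t < g x} * indicator {0..1} t \<partial>lborel)
      = (\<integral>\<^sup>+t. (\<integral>\<^sup>+x. indicator {x \<in> space M. ennreal t < g x} x * indicator {0..1} t \<partial>M) \<partial>lborel)"
    by (intro nn_integral_cong) (simp add: nn_integral_multc)
  also have "\<dots> = (\<integral>\<^sup>+x. (\<integral>\<^sup>+t. indicator {x \<in> space M. ennreal t < g x} x * indicator {0..1} t \<partial>lborel) \<partial>M)"
    by (rule Fubini') measurable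
  also have "\<dots> = (\<integral>\<^sup>+x. g x \<partial>M)"
  proof (rule nn_integral_cong)
    fix x assume x: "x \<in> space M"
    then obtain r where r: "g x = ennreal r" "0 \<le> r" "r \<le> 1"
      using le[OF x] by (cases "g x") (auto simp: top_unique)
    have "(\<integral>\<^sup>+t. indicator {x \<in> space M. ennreal t < g x} x * indicator {0..1} t \<partial>lborel)
        = (\<integral>\<^sup>+t. indicator {0..<r} t \<partial>lborel)"
      using x r by (intro nn_integral_cong) (auto simp: indicator_def ennreal_less_iff)
    then show "(\<integral>\<^sup>+t. indicator {x \<in> space M. ennreal t < g x} x * indicator {0..1} t \<partial>lborel) = g x"
      using r by simp
  qed
  finally show ?thesis ..
qed

text \<open>The total variation distance controls every superlevel set of \<open>g\<close>, hence the integral of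
  \<open>g\<close> by the layer-cake formula on both sides.\<close>

lemma nn_integral_le_nn_integral_plus_tv_dist:
  fixes g :: "'a \<Rightarrow> ennreal"
  assumes P: "prob_space P" and Q: "prob_space Q" and sets: "sets Q = sets P"
    and g: "g \<in> borel_measurable P" and le: "\<And>x. x \<in> space P \<Longrightarrow> g x \<le> 1"
  shows "(\<integral>\<^sup>+x. g x \<partial>P) \<le> (\<integral>\<^sup>+x. g x \<partial>Q) + ennreal (tv_dist P Q)"
proof -
  interpret P: prob_space P by fact
  interpret Q: prob_space Q by fact
  note [measurable] = g
  have g'[measurable]: "g \<in> borel_measurable Q" by (simp add: measurable_cong_sets[OF sets refl])
  have sp: "space Q = space P" by (rule sets_eq_imp_space_eq[OF sets])
  have [measurable]: "(\<lambda>t. emeasure Q {x \<in> space Q. ennreal t < g x}) \<in> borel_measurable borel"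
  proof -
    have "{p \<in> space (borel \<Otimes>\<^sub>M Q). ennreal (fst p) < g (snd p)} \<in> sets (borel \<Otimes>\<^sub>M Q)"
      by measurable
    from Q.measurable_emeasure_Pair[OF this] show ?thesis
      by (simp add: vimage_def space_pair_measure)
  qed
  have tail: "emeasure P {x \<in> space P. ennreal t < g x}
      \<le> emeasure Q {x \<in> space P. ennreal t < g x} + ennreal (tv_dist P Q)" for t
  proof -
    have A: "{x \<in> space P. ennreal t < g x} \<in> sets P" by measurable
    show ?thesis
      using measure_diff_le_tv_dist[OF P Q A] tv_dist_nonneg[OF P Q]
      by (simp add: P.emeasure_eq_measure Q.emeasure_eq_measure flip: ennreal_plus)
  qed
  have layer_P: "(\<integral>\<^sup>+x. g x \<partial>P)
      = (\<integral>\<^sup>+t. emeasure P {x \<in> space P. ennreal t < g x} * indicator {0..1} t \<partial>lborel)"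
    using le by (rule nn_integral_layer_cake_unit[OF P.sigma_finite_measure_axioms g])
  have layer_Q: "(\<integral>\<^sup>+x. g x \<partial>Q)
      = (\<integral>\<^sup>+t. emeasure Q {x \<in> space Q. ennreal t < g x} * indicator {0..1} t \<partial>lborel)"
    using le unfolding sp[symmetric]
    by (rule nn_integral_layer_cake_unit[OF Q.sigma_finite_measure_axioms g'])
  have "(\<integral>\<^sup>+x. g x \<partial>P)
      \<le> (\<integral>\<^sup>+t. emeasure Q {x \<in> space Q. ennreal t < g x} * indicator {0..1} t
             + ennreal (tv_dist P Q) * indicator {0..1::real} t \<partial>lborel)"
    unfolding layer_P using tail by (intro nn_integral_mono) (auto simp: indicator_def sp)
  also have "\<dots> = (\<integral>\<^sup>+x. g x \<partial>Q) + ennreal (tv_dist P Q)"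
    unfolding layer_Q by (subst nn_integral_add) (auto simp: nn_integral_cmult_indicator)
  finally show ?thesis .
qed

section \<open>Noncoverage as a function of the bag\<close>

text \<open>The condition for the point \<open>p\<close> of the bag \<open>B\<close> to score above the weighted \<open>\<tau>\<close>-quantile, in
  terms of \<open>p\<close> and \<open>B\<close> only: the points that score strictly below \<open>p\<close> already have the fraction
  \<open>\<tau>\<close> of the total weight. In this form invariance under permutations of the dataset is immediate,
  no quantile has to be shown measurable, and the case \<open>\<tau> = 0\<close> with quantile \<open>-\<infinity>\<close> is not
  exceptional.\<close>

definition uncovered ::
  "('z \<Rightarrow> 'z multiset \<Rightarrow> real) \<Rightarrow> ('z \<Rightarrow> real) \<Rightarrow> real \<Rightarrow> 'z multiset \<Rightarrow> 'z \<Rightarrow> bool" where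
  "uncovered s w \<tau> B p \<longleftrightarrow>
     \<tau> * (\<Sum>q\<in>#B. w q) \<le> (\<Sum>q\<in>#B. if s q B < s p B then w q else 0)"

lemma sum_bag: "(\<Sum>q\<in>#bag n z. f q) = (\<Sum>j=1..n+1. f (z j))"
  by (simp add: bag_def sum_unfold_sum_mset image_mset.compositionality comp_def)

lemma cdf_weighted_score_dist:
  assumes "\<And>j. j \<in> {1..n+1} \<Longrightarrow> 0 < w (z j)"
  shows "cdf (weighted_score_dist n s w z) x
    = (\<Sum>j=1..n+1. if score n s z j \<le> x then w (z j) else 0) / (\<Sum>j=1..n+1. w (z j))"
proof -
  define c where "c = (\<lambda>j. w (z j) / (\<Sum>j=1..n+1. w (z j)))"
  have c: "0 \<le> c j" if "j \<in> {1..n+1}" for j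
    unfolding c_def using assms that by (intro divide_nonneg_nonneg sum_nonneg) (auto intro: less_imp_le)
  have "emeasure (weighted_score_dist n s w z) {..x}
      = (\<Sum>j\<in>{1..n+1}. ennreal (c j) * indicator {..x} (score n s z j))"
    unfolding weighted_score_dist_def c_def by (subst emeasure_mixture) auto
  also have "\<dots> = (\<Sum>j\<in>{1..n+1}. ennreal (if score n s z j \<le> x then c j else 0))"
    by (intro sum.cong) (auto simp: indicator_def)
  also have "\<dots> = ennreal (\<Sum>j\<in>{1..n+1}. if score n s z j \<le> x then c j else 0)"
    using c by (intro sum_ennreal) auto
  finally have "cdf (weighted_score_dist n s w z) x = (\<Sum>j=1..n+1. if score n s z j \<le> x then c j else 0)"
    unfolding cdf_def measure_def using c by (simp only:) (intro enn2real_ennreal sum_nonneg, auto)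
  also have "\<dots> = (\<Sum>j=1..n+1. if score n s z j \<le> x then w (z j) else 0) / (\<Sum>j=1..n+1. w (z j))"
    unfolding sum_divide_distrib by (intro sum.cong) (auto simp: c_def)
  finally show ?thesis .
qed

text \<open>The score of \<open>z k\<close> exceeds the quantile if and only if the distribution function reaches
  \<open>\<tau>\<close> at some \<open>x\<close> strictly below that score. It is a step function, so the last jump before the
  score is the best such \<open>x\<close>.\<close>

lemma score_le_quantile_iff:
  assumes w: "\<And>j. j \<in> {1..n+1} \<Longrightarrow> 0 < w (z j)"
  shows "ereal (score n s z k) \<le> quantile \<tau> (weighted_score_dist n s w z)
    \<longleftrightarrow> \<not> uncovered s w \<tau> (bag n z) (z k)"
proof -
  define W where "W = (\<Sum>j=1..n+1. w (z j))"
  have W: "0 < W" unfolding W_def using w by (intro sum_pos) auto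
  let ?S = "score n s z"
  have unc: "uncovered s w \<tau> (bag n z) (z k)
      \<longleftrightarrow> \<tau> * W \<le> (\<Sum>j=1..n+1. if ?S j < ?S k then w (z j) else 0)"
    by (simp only: uncovered_def sum_bag W_def score_def)
  have cdf: "\<tau> \<le> cdf (weighted_score_dist n s w z) x
      \<longleftrightarrow> \<tau> * W \<le> (\<Sum>j=1..n+1. if ?S j \<le> x then w (z j) else 0)" for x
    using W cdf_weighted_score_dist[of n w z s x, OF w] by (simp add: W_def pos_le_divide_eq)
  have "(\<exists>x < ?S k. \<tau> \<le> cdf (weighted_score_dist n s w z) x)
      \<longleftrightarrow> uncovered s w \<tau> (bag n z) (z k)"
  proof
    assume "\<exists>x < ?S k. \<tau> \<le> cdf (weighted_score_dist n s w z) x"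
    then obtain x where x: "x < ?S k" "\<tau> * W \<le> (\<Sum>j=1..n+1. if ?S j \<le> x then w (z j) else 0)"
      unfolding cdf by blast
    note x(2)
    also have "(\<Sum>j=1..n+1. if ?S j \<le> x then w (z j) else 0)
        \<le> (\<Sum>j=1..n+1. if ?S j < ?S k then w (z j) else 0)"
      using x(1) w by (intro sum_mono) (auto intro: less_imp_le)
    finally show "uncovered s w \<tau> (bag n z) (z k)" unfolding unc .
  next
    assume u: "uncovered s w \<tau> (bag n z) (z k)"
    \<comment> \<open>The inserted \<open>?S k - 1\<close> makes the maximum defined when no score is below \<open>?S k\<close>.\<close>
    define x where "x = Max (insert (?S k - 1) {?S j |j. j \<in> {1..n+1} \<and> ?S j < ?S k})"
    have fin: "finite (insert (?S k - 1) {?S j |j. j \<in> {1..n+1} \<and> ?S j < ?S k})" by simp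
    have x: "x < ?S k" unfolding x_def using fin by (subst Max_less_iff) auto
    have "?S j \<le> x \<longleftrightarrow> ?S j < ?S k" if "j \<in> {1..n+1}" for j
    proof
      assume "?S j < ?S k"
      then show "?S j \<le> x" unfolding x_def using fin that by (intro Max_ge) auto
    qed (use x in simp)
    then have "(\<Sum>j=1..n+1. if ?S j \<le> x then w (z j) else 0)
        = (\<Sum>j=1..n+1. if ?S j < ?S k then w (z j) else 0)"
      by (intro sum.cong) auto
    with u x show "\<exists>x < ?S k. \<tau> \<le> cdf (weighted_score_dist n s w z) x"
      unfolding unc cdf by auto
  qed
  then show ?thesis
    unfolding quantile_def le_INF_iff by (auto simp: not_le)
qed

text \<open>Take an uncovered point \<open>p0\<close> with the smallest score. All points scoring strictly below \<open>p0\<close>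
  are covered, and because \<open>p0\<close> is uncovered they have weight at least \<open>\<tau>\<close> times the total.\<close>

lemma sum_uncovered_le:
  assumes w: "\<And>q. q \<in># B \<Longrightarrow> 0 \<le> w q" and \<tau>: "\<tau> \<le> 1"
  shows "(\<Sum>p\<in>#B. if uncovered s w \<tau> B p then w p else 0) \<le> (1 - \<tau>) * (\<Sum>p\<in>#B. w p)"
proof (cases "\<exists>p\<in>#B. uncovered s w \<tau> B p")
  case False
  then have "(\<Sum>p\<in>#B. if uncovered s w \<tau> B p then w p else 0) = (\<Sum>p\<in>#B. 0)"
    by (intro arg_cong[where f=sum_mset] image_mset_cong) auto
  moreover have "(\<Sum>p\<in>#B. 0) \<le> (\<Sum>p\<in>#B. w p)" using w by (intro sum_mset_mono)
  ultimately show ?thesis using \<tau> by simp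
next
  case True
  let ?U = "{p \<in> set_mset B. uncovered s w \<tau> B p}"
  obtain p0 where p0: "p0 \<in> ?U" "\<And>p. p \<in> ?U \<Longrightarrow> s p0 B \<le> s p B"
    using True ex_min_if_finite[of "(\<lambda>p. s p B) ` ?U"] by (fastforce simp: not_less)
  have diff: "(\<Sum>p\<in>#C. f p - g p) = (\<Sum>p\<in>#C. f p) - (\<Sum>p\<in>#C. g p)" for C and f g :: "'a \<Rightarrow> real"
    by (induction C) simp_all
  have "(\<Sum>p\<in>#B. if uncovered s w \<tau> B p then w p else 0)
      \<le> (\<Sum>p\<in>#B. w p - (if s p B < s p0 B then w p else 0))"
    using p0(2) w by (intro sum_mset_mono) (auto simp: not_less[symmetric])
  also have "\<dots> = (\<Sum>p\<in>#B. w p) - (\<Sum>p\<in>#B. if s p B < s p0 B then w p else 0)"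
    by (rule diff)
  also have "\<dots> \<le> (\<Sum>p\<in>#B. w p) - \<tau> * (\<Sum>p\<in>#B. w p)"
    using p0(1) by (simp add: uncovered_def)
  finally show ?thesis by (simp add: left_diff_distrib)
qed

lemma measurable_uncovered:
  assumes w: "w \<in> borel_measurable N"
    and s: "(\<lambda>(p, z). s p (bag n z)) \<in> borel_measurable (N \<Otimes>\<^sub>M (\<Pi>\<^sub>M i\<in>{1..n+1}. N))"
    and k: "k \<in> {1..n+1}"
  shows "{z \<in> space (\<Pi>\<^sub>M i\<in>{1..n+1}. N). uncovered s w \<tau> (bag n z) (z k)} \<in> sets (\<Pi>\<^sub>M i\<in>{1..n+1}. N)"
proof -
  let ?D = "\<Pi>\<^sub>M i\<in>{1..n+1}. N"
  have coord: "(\<lambda>z. z j) \<in> measurable ?D N" if "j \<in> {1..n+1}" for j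
    by (rule measurable_component_singleton[OF that])
  have w_coord: "(\<lambda>z. w (z j)) \<in> borel_measurable ?D" if "j \<in> {1..n+1}" for j
    by (rule measurable_compose[OF coord[OF that] w])
  have s_coord: "(\<lambda>z. s (z j) (bag n z)) \<in> borel_measurable ?D" if "j \<in> {1..n+1}" for j
    using measurable_compose[OF measurable_Pair[OF coord[OF that] measurable_ident] s] by simp
  note [measurable] = s_coord[OF k]
  have "(\<lambda>z. if s (z j) (bag n z) < s (z k) (bag n z) then w (z j) else 0) \<in> borel_measurable ?D"
    if "j \<in> {1..n+1}" for j
  proof -
    note [measurable] = s_coord[OF that] w_coord[OF that]
    show ?thesis by measurable
  qed
  then have [measurable]: "(\<lambda>z. \<Sum>j=1..n+1. if s (z j) (bag n z) < s (z k) (bag n z) then w (z j) else 0)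
      \<in> borel_measurable ?D"
    by (rule borel_measurable_sum)
  have [measurable]: "(\<lambda>z. \<Sum>j=1..n+1. w (z j)) \<in> borel_measurable ?D"
    using w_coord by (rule borel_measurable_sum)
  show ?thesis unfolding uncovered_def sum_bag by measurable
qed

section \<open>Exchanging a training point with the test point\<close>

locale training_laws =
  fixes N :: "'z measure" and n :: nat and F :: "nat \<Rightarrow> 'z measure"
  assumes n_pos: "1 \<le> n"
    and prob_F: "\<And>i. i \<in> {1..n} \<Longrightarrow> prob_space (F i)"
    and sets_F: "\<And>i. i \<in> {1..n} \<Longrightarrow> sets (F i) = sets N"
begin

abbreviation average :: "'z measure" where
  "average \<equiv> mixture N {1..n} (\<lambda>_. 1 / real n) F"

abbreviation data :: "(nat \<Rightarrow> 'z) measure" where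
  "data \<equiv> \<Pi>\<^sub>M k\<in>{1..n+1}. N"

definition with_test_law :: "'z measure \<Rightarrow> (nat \<Rightarrow> 'z) measure" where
  "with_test_law Q = (\<Pi>\<^sub>M k\<in>{1..n+1}. if k \<in> {1..n} then F k else Q)"

lemma nn_integral_average:
  assumes "f \<in> borel_measurable N"
  shows "of_nat n * (\<integral>\<^sup>+x. f x \<partial>average) = (\<Sum>i=1..n. \<integral>\<^sup>+x. f x \<partial>F i)"
proof -
  have "of_nat n * ennreal (1 / real n) = 1"
    using n_pos by (simp add: ennreal_of_nat_eq_real_of_nat flip: ennreal_mult')
  then show ?thesis
    using assms sets_F
    by (subst nn_integral_mixture) (simp_all only: sum_distrib_left[symmetric] mult.assoc[symmetric], auto)
qed

lemma prob_space_average: "prob_space average"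
proof
  have "emeasure average (space N) = (\<Sum>i\<in>{1..n}. ennreal (1 / real n) * 1)"
    using sets_F prob_F by (subst emeasure_mixture)
      (auto intro!: sum.cong simp: prob_space.emeasure_space_1 simp flip: sets_eq_imp_space_eq[OF sets_F])
  also have "\<dots> = 1"
    using n_pos by (simp add: ennreal_of_nat_eq_real_of_nat flip: ennreal_mult')
  finally show "emeasure average (space average) = 1" by simp
qed

lemma sets_with_test_law [simp, measurable_cong]:
  assumes "sets Q = sets N"
  shows "sets (with_test_law Q) = sets data"
  unfolding with_test_law_def using assms sets_F by (intro sets_PiM_cong) auto

lemma
  assumes Q: "prob_space Q" "sets Q = sets N" and f: "f \<in> borel_measurable data"
  shows nn_integral_with_test_law: "(\<integral>\<^sup>+z. f z \<partial>with_test_law Q)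
      = (\<integral>\<^sup>+q. (\<integral>\<^sup>+z. f (z(n+1 := q)) \<partial>(\<Pi>\<^sub>M k\<in>{1..n}. F k)) \<partial>Q)"
    and measurable_train_integral:
      "(\<lambda>q. \<integral>\<^sup>+z. f (z(n+1 := q)) \<partial>(\<Pi>\<^sub>M k\<in>{1..n}. F k)) \<in> borel_measurable N"
proof -
  \<comment> \<open>The theory of product measures asks for a probability measure at every index, and \<open>F\<close> is
    one only on \<open>{1..n}\<close>.\<close>
  define F' where "F' = (\<lambda>k. if k \<in> {1..n} then F k else Q)"
  have prob: "prob_space (F' k)" for k using Q(1) prob_F by (simp add: F'_def)
  interpret product_prob_space F'
    using prob by (simp add: product_prob_space_def product_prob_space_axioms_def
      product_sigma_finite_def prob_space_imp_sigma_finite)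
  interpret T: prob_space "Pi\<^sub>M {1..n} F'" using prob by (intro prob_space_PiM)
  have train: "Pi\<^sub>M {1..n} F' = (\<Pi>\<^sub>M k\<in>{1..n}. F k)" by (intro PiM_cong) (auto simp: F'_def)
  have ins: "{1..n+1} = insert (n+1) {1..n}" by auto
  have whole: "with_test_law Q = Pi\<^sub>M (insert (n+1) {1..n}) F'"
    by (simp only: with_test_law_def F'_def ins)
  have test: "F' (n+1) = Q" by (simp add: F'_def)
  have f'[measurable]: "f \<in> borel_measurable (Pi\<^sub>M (insert (n+1) {1..n}) F')"
    using f unfolding whole[symmetric] by (simp add: measurable_cong_sets[OF sets_with_test_law[OF Q(2)] refl])
  show "(\<integral>\<^sup>+z. f z \<partial>with_test_law Q)
      = (\<integral>\<^sup>+q. (\<integral>\<^sup>+z. f (z(n+1 := q)) \<partial>(\<Pi>\<^sub>M k\<in>{1..n}. F k)) \<partial>Q)"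
    unfolding whole by (subst product_nn_integral_insert_rev[OF _ _ f']) (simp_all only: test train, auto)
  have "(\<lambda>q. \<integral>\<^sup>+z. f (z(n+1 := q)) \<partial>Pi\<^sub>M {1..n} F') \<in> borel_measurable (F' (n+1))"
    by measurable
  then show "(\<lambda>q. \<integral>\<^sup>+z. f (z(n+1 := q)) \<partial>(\<Pi>\<^sub>M k\<in>{1..n}. F k)) \<in> borel_measurable N"
    unfolding test train by (simp add: measurable_cong_sets[OF Q(2) refl])
qed

text \<open>The law of the data is affine in the law of the test point.\<close>

lemma nn_integral_with_test_law_average:
  assumes f: "f \<in> borel_measurable data"
  shows "of_nat n * (\<integral>\<^sup>+z. f z \<partial>with_test_law average)
    = (\<Sum>i=1..n. \<integral>\<^sup>+z. f z \<partial>with_test_law (F i))"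
  unfolding nn_integral_with_test_law[OF prob_space_average sets_mixture f]
    nn_integral_average[OF measurable_train_integral[OF prob_space_average sets_mixture f]]
  by (intro sum.cong refl nn_integral_with_test_law[symmetric] prob_F sets_F f)

text \<open>Change of measure in the test coordinate.\<close>

lemma nn_integral_with_test_law_density:
  assumes G: "prob_space G" "sets G = sets N"
    and i: "i \<in> {1..n}" and r: "r \<in> borel_measurable N" "density (F i) r = G"
    and f: "f \<in> borel_measurable data"
  shows "(\<integral>\<^sup>+z. f z \<partial>with_test_law G) = (\<integral>\<^sup>+z. r (z (n+1)) * f z \<partial>with_test_law (F i))"
proof -
  note [measurable] = r(1) f
  let ?T = "\<Pi>\<^sub>M k\<in>{1..n}. F k"
  note m = measurable_train_integral[OF G f]
  have rf: "(\<lambda>z. r (z (n+1)) * f z) \<in> borel_measurable data" by measurable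
  have upd: "(\<lambda>z. f (z(n+1 := q))) \<in> borel_measurable ?T" if "q \<in> space N" for q
  proof -
    have "(\<lambda>z. z(n+1 := q)) \<in> measurable ?T data"
      using that by (intro measurable_fun_upd[where J="{1..n}"])
        (auto intro!: measurable_ident_sets sets_PiM_cong sets_F)
    then show ?thesis by measurable
  qed
  have "(\<integral>\<^sup>+z. f z \<partial>with_test_law G) = (\<integral>\<^sup>+q. (\<integral>\<^sup>+z. f (z(n+1 := q)) \<partial>?T) \<partial>density (F i) r)"
    unfolding r(2) by (rule nn_integral_with_test_law[OF G f])
  also have "\<dots> = (\<integral>\<^sup>+q. r q * (\<integral>\<^sup>+z. f (z(n+1 := q)) \<partial>?T) \<partial>F i)"
    using r(1) m by (intro nn_integral_density) (simp_all add: measurable_cong_sets[OF sets_F[OF i] refl])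
  also have "\<dots> = (\<integral>\<^sup>+q. (\<integral>\<^sup>+z. r q * f (z(n+1 := q)) \<partial>?T) \<partial>F i)"
    using upd sets_eq_imp_space_eq[OF sets_F[OF i]]
    by (intro nn_integral_cong nn_integral_cmult[symmetric]) simp
  also have "\<dots> = (\<integral>\<^sup>+z. r (z (n+1)) * f z \<partial>with_test_law (F i))"
    by (subst nn_integral_with_test_law[OF prob_F[OF i] sets_F[OF i] rf]) simp
  finally show ?thesis .
qed

lemma nn_integral_with_test_law_coordinate:
  assumes Q: "prob_space Q" "sets Q = sets N" and k: "k \<in> {1..n+1}"
    and g: "g \<in> borel_measurable N"
  shows "(\<integral>\<^sup>+z. g (z k) \<partial>with_test_law Q) = (\<integral>\<^sup>+x. g x \<partial>(if k \<in> {1..n} then F k else Q))"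
proof -
  let ?F = "\<lambda>k. if k \<in> {1..n} then F k else Q"
  have "distr (Pi\<^sub>M {1..n+1} ?F) (?F k) (\<lambda>z. z k) = ?F k"
    using prob_F Q k by (intro distr_PiM_component) auto
  then have "(\<integral>\<^sup>+x. g x \<partial>?F k) = (\<integral>\<^sup>+x. g x \<partial>distr (Pi\<^sub>M {1..n+1} ?F) (?F k) (\<lambda>z. z k))"
    by simp
  also have "\<dots> = (\<integral>\<^sup>+z. g (z k) \<partial>Pi\<^sub>M {1..n+1} ?F)"
    using g k sets_F Q by (intro nn_integral_distr measurable_component_singleton)
      (auto simp: measurable_cong_sets[OF Q(2) refl] measurable_cong_sets[OF sets_F refl])
  finally show ?thesis by (simp add: with_test_law_def)
qed

text \<open>The restriction to \<open>{1..n+1}\<close> keeps the value in the product space, whose elements are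
  undefined outside the index set.\<close>

definition swap_test :: "nat \<Rightarrow> (nat \<Rightarrow> 'z) \<Rightarrow> nat \<Rightarrow> 'z" where
  "swap_test i z = (\<lambda>k\<in>{1..n+1}. z (Transposition.transpose i (n+1) k))"

lemma bag_swap_test:
  assumes i: "i \<in> {1..n}"
  shows "bag n (swap_test i z) = bag n z"
proof -
  let ?t = "Transposition.transpose i (n+1)"
  have t: "?t ` {1..n+1} = {1..n+1}" using i by (intro transpose_image_eq) auto
  have "bag n (swap_test i z) = image_mset z (image_mset ?t (mset_set {1..n+1}))"
    unfolding bag_def image_mset.compositionality by (intro image_mset_cong) (auto simp: swap_test_def)
  also have "image_mset ?t (mset_set {1..n+1}) = mset_set (?t ` {1..n+1})"
    by (intro image_mset_mset_set) (auto intro: inj_on_subset[OF inj_transpose])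
  finally show ?thesis unfolding t bag_def .
qed

text \<open>When the test point has the law of the \<open>i\<close>th training point, the swapped coordinates are
  independent with equal laws.\<close>

lemma nn_integral_swap_test:
  assumes i: "i \<in> {1..n}" and f: "f \<in> borel_measurable data"
  shows "(\<integral>\<^sup>+z. f (swap_test i z) \<partial>with_test_law (F i)) = (\<integral>\<^sup>+z. f z \<partial>with_test_law (F i))"
proof -
  let ?t = "Transposition.transpose i (n+1)"
  let ?F = "\<lambda>k. if k \<in> {1..n} then F k else F i"
  have F_t: "?F (?t k) = ?F k" if "k \<in> {1..n+1}" for k
    using i that by (auto simp: Transposition.transpose_def)
  have t_mem: "?t k \<in> {1..n+1}" if "k \<in> {1..n+1}" for k
    using i that by (auto simp: Transposition.transpose_def)
  have F_t_PiM: "(\<Pi>\<^sub>M k\<in>{1..n+1}. ?F (?t k)) = with_test_law (F i)"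
    unfolding with_test_law_def using F_t by (intro PiM_cong) auto
  have distr: "distr (with_test_law (F i)) (with_test_law (F i)) (swap_test i) = with_test_law (F i)"
    using distr_PiM_reindex[of "{1..n+1}" ?F ?t "{1..n+1}"] t_mem prob_F i
    unfolding F_t_PiM swap_test_def[abs_def] with_test_law_def[symmetric]
    by (auto intro: inj_on_subset[OF inj_transpose])
  note sets_H = sets_with_test_law[OF sets_F[OF i]]
  have swap: "swap_test i \<in> measurable data data"
    unfolding swap_test_def[abs_def] using t_mem
    by (intro measurable_restrict measurable_component_singleton) auto
  have "(\<integral>\<^sup>+z. f z \<partial>with_test_law (F i))
      = (\<integral>\<^sup>+z. f z \<partial>distr (with_test_law (F i)) (with_test_law (F i)) (swap_test i))"
    by (simp only: distr)
  also have "\<dots> = (\<integral>\<^sup>+z. f (swap_test i z) \<partial>with_test_law (F i))"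
    using swap f unfolding measurable_cong_sets[OF sets_H sets_H, symmetric]
    by (intro nn_integral_distr)
      (simp_all only: measurable_distr_eq1 measurable_cong_sets[OF sets_H refl])
  finally show ?thesis ..
qed

text \<open>Integrating out the training data leaves a function \<open>h\<close> of the test point. The domination of
  \<open>f\<close> by a function of the \<open>i\<close>th training point alone, whose mean is at most 1, forces \<open>h \<le> 1\<close>
  although \<open>f\<close> itself may be unbounded; so the change of the test law costs at most one total
  variation distance.\<close>

lemma nn_integral_with_test_law_le_average:
  assumes i: "i \<in> {1..n}" and f: "f \<in> borel_measurable data"
    and m: "m \<in> borel_measurable N" "(\<integral>\<^sup>+x. m x \<partial>F i) \<le> 1"
    and le: "\<And>z. f z \<le> m (z i)"
  shows "(\<integral>\<^sup>+z. f z \<partial>with_test_law (F i))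
    \<le> (\<integral>\<^sup>+z. f z \<partial>with_test_law average) + ennreal (tv_dist (F i) average)"
proof -
  let ?T = "\<Pi>\<^sub>M k\<in>{1..n}. F k"
  define h where "h = (\<lambda>q. \<integral>\<^sup>+z. f (z(n+1 := q)) \<partial>?T)"
  have "h q \<le> 1" for q
  proof -
    have "(\<integral>\<^sup>+z. f (z(n+1 := q)) \<partial>?T) \<le> (\<integral>\<^sup>+z. m (z i) \<partial>?T)"
      using i le[of "z(n+1 := q)" for z] by (intro nn_integral_mono) auto
    also have "\<dots> = (\<integral>\<^sup>+x. m x \<partial>distr ?T (F i) (\<lambda>z. z i))"
      using i m(1) by (intro nn_integral_distr[symmetric] measurable_component_singleton)
        (simp_all add: measurable_cong_sets[OF sets_F[OF i] refl])
    also have "distr ?T (F i) (\<lambda>z. z i) = F i"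
      using i prob_F by (intro distr_PiM_component) auto
    finally show ?thesis using m(2) unfolding h_def by (rule order_trans)
  qed
  moreover have "h \<in> borel_measurable N"
    unfolding h_def by (rule measurable_train_integral[OF prob_F[OF i] sets_F[OF i] f])
  ultimately have "(\<integral>\<^sup>+q. h q \<partial>F i) \<le> (\<integral>\<^sup>+q. h q \<partial>average) + ennreal (tv_dist (F i) average)"
    using i by (intro nn_integral_le_nn_integral_plus_tv_dist prob_F prob_space_average)
      (simp_all add: sets_F measurable_cong_sets[OF sets_F[OF i] refl])
  then show ?thesis
    unfolding h_def nn_integral_with_test_law[OF prob_F[OF i] sets_F[OF i] f, symmetric]
      nn_integral_with_test_law[OF prob_space_average sets_mixture f, symmetric] .
qed

text \<open>The rule \<open>U\<close> is any rejection rule that sees a point and the bag of the dataset and, on each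
  dataset, rejects points of at most the fraction \<open>a\<close> of the total weight. Both sides are multiplied by \<open>n\<close> to keep division out of the extended
  nonnegative reals, where moreover \<open>r i x - v x\<close> is truncated at 0 and so is the positive part.\<close>

lemma weighted_rejection_bound:
  fixes G :: "'z measure" and r :: "nat \<Rightarrow> 'z \<Rightarrow> ennreal" and v :: "'z \<Rightarrow> ennreal"
    and U :: "'z multiset \<Rightarrow> 'z \<Rightarrow> bool" and a :: ennreal
  assumes G: "prob_space G" "sets G = sets N"
    and r: "\<And>i. i \<in> {1..n} \<Longrightarrow> r i \<in> borel_measurable N"
      "\<And>i. i \<in> {1..n} \<Longrightarrow> density (F i) (r i) = G"
    and v: "v \<in> borel_measurable N" "(\<integral>\<^sup>+x. v x \<partial>average) = 1"
    and U: "\<And>k. k \<in> {1..n+1} \<Longrightarrow> {z \<in> space data. U (bag n z) (z k)} \<in> sets data"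
    and level: "\<And>z. z \<in> space data \<Longrightarrow>
      (\<Sum>k=1..n+1. if U (bag n z) (z k) then v (z k) else 0) \<le> a * (\<Sum>k=1..n+1. v (z k))"
  shows "of_nat n * emeasure (with_test_law G) {z \<in> space data. U (bag n z) (z (n+1))}
    \<le> of_nat n * a + (\<Sum>i=1..n. (\<integral>\<^sup>+x. r i x - v x \<partial>F i) + ennreal (tv_dist (F i) average))"
proof -
  define e :: "nat \<Rightarrow> (nat \<Rightarrow> 'z) \<Rightarrow> ennreal"
    where "e k z = indicator {z. U (bag n z) (z k)} z" for k z
  have e_le: "c * e k z \<le> c" for c k z by (auto simp: e_def indicator_def)
  have e_meas: "e k \<in> borel_measurable data" if "k \<in> {1..n+1}" for k
  proof -
    have "indicator {z \<in> space data. U (bag n z) (z k)} \<in> borel_measurable data"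
      using U[OF that] by (rule borel_measurable_indicator)
    then show ?thesis
      by (subst measurable_cong[where g="indicator {z \<in> space data. U (bag n z) (z k)}"])
        (auto simp: e_def indicator_def)
  qed
  have ve_meas: "(\<lambda>z. g (z k) * e k z) \<in> borel_measurable data"
    if "k \<in> {1..n+1}" "g \<in> borel_measurable N" for k g
    using that(1) by (intro borel_measurable_times_ennreal e_meas measurable_compose[OF _ that(2)]
      measurable_component_singleton) auto

  define p where "p = emeasure (with_test_law G) {z \<in> space data. U (bag n z) (z (n+1))}"
  define D where "D i = (\<integral>\<^sup>+x. r i x - v x \<partial>F i)" for i
  define T where "T i = ennreal (tv_dist (F i) average)" for i
  define A where "A = (\<integral>\<^sup>+z. v (z (n+1)) * e (n+1) z \<partial>with_test_law average)"
  define b where "b i = (\<integral>\<^sup>+z. v (z i) * e i z \<partial>with_test_law average)" for i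

  have p_le: "p \<le> D i + (\<integral>\<^sup>+z. min (r i (z (n+1))) (v (z (n+1))) * e (n+1) z \<partial>with_test_law (F i))"
    if i: "i \<in> {1..n}" for i
  proof -
    let ?H = "with_test_law (F i)" and ?m = "\<lambda>x. min (r i x) (v x)"
    note cong = measurable_cong_sets[OF sets_with_test_law[OF sets_F[OF i]] refl]
    have m: "?m \<in> borel_measurable N" using r(1)[OF i] v(1) by measurable
    have d: "(\<lambda>x. r i x - v x) \<in> borel_measurable N" using r(1)[OF i] v(1) by measurable
    have d': "(\<lambda>z. r i (z (n+1)) - v (z (n+1))) \<in> borel_measurable data"
      by (rule measurable_compose[OF _ d]) (simp add: measurable_component_singleton)
    have split: "r i x \<le> (r i x - v x) + ?m x" for x
      by (cases "r i x \<le> v x") (auto simp: min_def not_le diff_add_cancel_ennreal)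
    have "p = (\<integral>\<^sup>+z. e (n+1) z \<partial>with_test_law G)"
    proof -
      have "p = (\<integral>\<^sup>+z. indicator {z \<in> space data. U (bag n z) (z (n+1))} z \<partial>with_test_law G)"
        unfolding p_def using U[of "n+1"] G(2) by (subst nn_integral_indicator) simp_all
      also have "\<dots> = (\<integral>\<^sup>+z. e (n+1) z \<partial>with_test_law G)"
        using sets_eq_imp_space_eq[OF sets_with_test_law[OF G(2)]]
        by (intro nn_integral_cong) (simp add: e_def indicator_def)
      finally show ?thesis .
    qed
    also have "\<dots> = (\<integral>\<^sup>+z. r i (z (n+1)) * e (n+1) z \<partial>?H)"
      using i by (intro nn_integral_with_test_law_density G r e_meas) auto
    also have "\<dots> \<le> (\<integral>\<^sup>+z. (r i (z (n+1)) - v (z (n+1))) + ?m (z (n+1)) * e (n+1) z \<partial>?H)"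
    proof (rule nn_integral_mono)
      fix z
      have "r i (z (n+1)) * e (n+1) z
          \<le> ((r i (z (n+1)) - v (z (n+1))) + ?m (z (n+1))) * e (n+1) z"
        by (intro mult_right_mono split) simp
      also have "\<dots> \<le> (r i (z (n+1)) - v (z (n+1))) + ?m (z (n+1)) * e (n+1) z"
        unfolding distrib_right by (intro add_right_mono e_le)
      finally show "r i (z (n+1)) * e (n+1) z
          \<le> (r i (z (n+1)) - v (z (n+1))) + ?m (z (n+1)) * e (n+1) z" .
    qed
    also have "\<dots> = (\<integral>\<^sup>+z. r i (z (n+1)) - v (z (n+1)) \<partial>?H) + (\<integral>\<^sup>+z. ?m (z (n+1)) * e (n+1) z \<partial>?H)"
      unfolding cong[symmetric]
      using ve_meas[OF _ m, of "n+1"] d'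
      by (intro nn_integral_add) (simp_all add: cong)
    also have "(\<integral>\<^sup>+z. r i (z (n+1)) - v (z (n+1)) \<partial>?H) = D i"
      using nn_integral_with_test_law_coordinate[OF prob_F[OF i] sets_F[OF i] _ d, of "n+1"]
      by (simp add: D_def)
    finally show ?thesis .
  qed

  have "of_nat n * p = (\<Sum>i=1..n. p)" by simp
  also have "\<dots> \<le> (\<Sum>i=1..n. D i + (\<integral>\<^sup>+z. v (z (n+1)) * e (n+1) z \<partial>with_test_law (F i)))"
  proof (rule sum_mono)
    fix i assume "i \<in> {1..n}"
    then show "p \<le> D i + (\<integral>\<^sup>+z. v (z (n+1)) * e (n+1) z \<partial>with_test_law (F i))"
      by (rule order_trans[OF p_le]) (intro add_left_mono nn_integral_mono mult_right_mono, auto)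
  qed
  also have "\<dots> = (\<Sum>i=1..n. D i) + of_nat n * A"
    unfolding sum.distrib A_def
    by (subst nn_integral_with_test_law_average) (simp_all add: ve_meas[OF _ v(1), of "n+1", simplified])
  finally have replace: "of_nat n * p \<le> (\<Sum>i=1..n. D i) + of_nat n * A" .

  have "p \<le> D i + (b i + T i)" if i: "i \<in> {1..n}" for i
  proof -
    let ?H = "with_test_law (F i)" and ?m = "\<lambda>x. min (r i x) (v x)"
    have m: "?m \<in> borel_measurable N" using r(1)[OF i] v(1) by measurable
    have "(\<integral>\<^sup>+x. r i x \<partial>F i) = emeasure G (space G)"
      using r(1)[OF i] unfolding r(2)[OF i, symmetric]
      by (subst emeasure_density)
        (simp_all add: measurable_cong_sets[OF sets_F[OF i] refl] cong: nn_integral_cong)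
    then have m1: "(\<integral>\<^sup>+x. ?m x \<partial>F i) \<le> 1"
      using prob_space.emeasure_space_1[OF G(1)] nn_integral_mono[of "F i" ?m "r i"] by simp
    have "(\<integral>\<^sup>+z. ?m (z (n+1)) * e (n+1) z \<partial>?H)
        = (\<integral>\<^sup>+z. ?m (swap_test i z (n+1)) * e (n+1) (swap_test i z) \<partial>?H)"
      using nn_integral_swap_test[OF i ve_meas[OF _ m, of "n+1"]] by simp
    also have "\<dots> = (\<integral>\<^sup>+z. ?m (z i) * e i z \<partial>?H)"
    proof -
      have last: "swap_test i z (n+1) = z i" for z by (simp add: swap_test_def)
      have "e (n+1) (swap_test i z) = e i z" for z
        by (simp only: e_def indicator_def mem_Collect_eq bag_swap_test[OF i] last)
      then show ?thesis by (simp only: last)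
    qed
    also have "\<dots> \<le> (\<integral>\<^sup>+z. ?m (z i) * e i z \<partial>with_test_law average) + T i"
      unfolding T_def using i
      by (intro nn_integral_with_test_law_le_average[OF _ _ m m1] ve_meas[OF _ m] e_le) auto
    also have "(\<integral>\<^sup>+z. ?m (z i) * e i z \<partial>with_test_law average) \<le> b i"
      unfolding b_def by (intro nn_integral_mono mult_right_mono) auto
    finally show ?thesis using order_trans[OF p_le[OF i]] by (simp add: add_left_mono)
  qed
  then have "(\<Sum>i=1..n. p) \<le> (\<Sum>i=1..n. D i + (b i + T i))" by (rule sum_mono)
  then have exchange: "of_nat n * p \<le> (\<Sum>i=1..n. D i + T i) + (\<Sum>i=1..n. b i)"
    by (simp add: sum.distrib ac_simps)

  have total: "A + (\<Sum>i=1..n. b i) \<le> of_nat (n+1) * a"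
  proof -
    note cong = measurable_cong_sets[OF sets_with_test_law[OF sets_mixture] refl]
    have v_meas: "(\<lambda>z. v (z k)) \<in> borel_measurable data" if "k \<in> {1..n+1}" for k
      by (rule measurable_compose[OF _ v(1)]) (rule measurable_component_singleton[OF that])
    have "A + (\<Sum>i=1..n. b i) = (\<Sum>k=1..n+1. \<integral>\<^sup>+z. v (z k) * e k z \<partial>with_test_law average)"
      by (simp add: A_def b_def add.commute)
    also have "\<dots> = (\<integral>\<^sup>+z. (\<Sum>k=1..n+1. v (z k) * e k z) \<partial>with_test_law average)"
      using ve_meas[OF _ v(1)] by (intro nn_integral_sum[symmetric]) (simp add: cong)
    also have "\<dots> \<le> (\<integral>\<^sup>+z. a * (\<Sum>k=1..n+1. v (z k)) \<partial>with_test_law average)"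
    proof (rule nn_integral_mono)
      fix z assume "z \<in> space (with_test_law average)"
      then have z: "z \<in> space data"
        using sets_eq_imp_space_eq[OF sets_with_test_law[OF sets_mixture]] by blast
      have "(\<Sum>k=1..n+1. v (z k) * e k z) = (\<Sum>k=1..n+1. if U (bag n z) (z k) then v (z k) else 0)"
        by (intro sum.cong) (auto simp: e_def indicator_def)
      then show "(\<Sum>k=1..n+1. v (z k) * e k z) \<le> a * (\<Sum>k=1..n+1. v (z k))"
        using level[OF z] by simp
    qed
    also have "\<dots> = a * (\<Sum>k=1..n+1. \<integral>\<^sup>+z. v (z k) \<partial>with_test_law average)"
      using v_meas by (subst nn_integral_cmult, simp add: cong, subst nn_integral_sum) (simp_all add: cong)
    also have "(\<Sum>k=1..n+1. \<integral>\<^sup>+z. v (z k) \<partial>with_test_law average)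
        = (\<Sum>k=1..n+1. \<integral>\<^sup>+x. v x \<partial>(if k \<in> {1..n} then F k else average))"
      by (intro sum.cong refl nn_integral_with_test_law_coordinate prob_space_average v) simp_all
    also have "\<dots> = (\<Sum>k=1..n. \<integral>\<^sup>+x. v x \<partial>F k) + 1"
      using v(2) by simp
    also have "\<dots> = of_nat (n+1)"
      using v nn_integral_average[OF v(1)] by simp
    finally show ?thesis by (simp add: mult.commute)
  qed

  \<comment> \<open>\<open>replace\<close> bounds \<open>p\<close> through \<open>A\<close> and \<open>exchange\<close> through the \<open>b i\<close>; with relative weights
    \<open>1 : n\<close> the two combine to exactly the sum bounded by \<open>total\<close>.\<close>
  have "of_nat (n+1) * (of_nat n * p) = of_nat n * p + of_nat n * (of_nat n * p)"
    by (simp add: distrib_right add.commute)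
  also have "\<dots> \<le> ((\<Sum>i=1..n. D i) + of_nat n * A)
      + of_nat n * ((\<Sum>i=1..n. D i + T i) + (\<Sum>i=1..n. b i))"
    by (intro add_mono mult_left_mono replace exchange) simp
  also have "\<dots> \<le> ((\<Sum>i=1..n. D i + T i) + of_nat n * A)
      + of_nat n * ((\<Sum>i=1..n. D i + T i) + (\<Sum>i=1..n. b i))"
    by (intro add_right_mono sum_mono) simp
  also have "\<dots> = of_nat (n+1) * (\<Sum>i=1..n. D i + T i) + of_nat n * (A + (\<Sum>i=1..n. b i))"
    by (simp add: algebra_simps)
  also have "\<dots> \<le> of_nat (n+1) * (\<Sum>i=1..n. D i + T i) + of_nat n * (of_nat (n+1) * a)"
    by (intro add_left_mono mult_left_mono total) simp
  also have "\<dots> = of_nat (n+1) * (of_nat n * a + (\<Sum>i=1..n. D i + T i))"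
    by (simp add: algebra_simps)
  finally have "of_nat n * p \<le> of_nat n * a + (\<Sum>i=1..n. D i + T i)"
    by (subst (asm) ennreal_mult_le_mult_iff) (simp_all del: of_nat_Suc of_nat_add)
  then show ?thesis by (simp add: p_def D_def T_def)
qed

end

section \<open>Coverage of the weighted conformal prediction set\<close>

theorem theorem12:
  fixes MX :: "'x measure" and MY :: "'y measure" and n :: nat
    and M :: "'a measure" and Z :: "nat \<Rightarrow> 'a \<Rightarrow> 'x \<times> 'y"
    and F :: "nat \<Rightarrow> ('x \<times> 'y) measure" and G Fbar :: "('x \<times> 'y) measure"
    and wstar :: "nat \<Rightarrow> 'x \<times> 'y \<Rightarrow> real" and w wbar :: "'x \<times> 'y \<Rightarrow> real"
    and s :: "'x \<times> 'y \<Rightarrow> ('x \<times> 'y) multiset \<Rightarrow> real" and \<alpha> :: real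
  assumes n: "n \<ge> 1"
    and F_prob: "\<And>i. i \<in> {1..n} \<Longrightarrow> prob_space (F i)"
    and F_sets: "\<And>i. i \<in> {1..n} \<Longrightarrow> sets (F i) = sets (MX \<Otimes>\<^sub>M MY)"
    and G_prob: "prob_space G"
    and G_sets: "sets G = sets (MX \<Otimes>\<^sub>M MY)"
    and wstar_meas: "\<And>i. i \<in> {1..n} \<Longrightarrow> wstar i \<in> borel_measurable (MX \<Otimes>\<^sub>M MY)"
    and wstar_nonneg: "\<And>i p. i \<in> {1..n} \<Longrightarrow> p \<in> space (MX \<Otimes>\<^sub>M MY) \<Longrightarrow> wstar i p \<ge> 0"
    and wstar_density: "\<And>i. i \<in> {1..n} \<Longrightarrow> density (F i) (\<lambda>p. ennreal (wstar i p)) = G"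
    and s_meas: "(\<lambda>(p, z). s p (bag n z))
        \<in> borel_measurable ((MX \<Otimes>\<^sub>M MY) \<Otimes>\<^sub>M (\<Pi>\<^sub>M i\<in>{1..n+1}. MX \<Otimes>\<^sub>M MY))"
    and M_prob: "prob_space M"
    and Z_indep: "prob_space.indep_vars M (\<lambda>_. MX \<Otimes>\<^sub>M MY) Z {1..n+1}"
    and Z_train: "\<And>i. i \<in> {1..n} \<Longrightarrow> distr M (MX \<Otimes>\<^sub>M MY) (Z i) = F i"
    and Z_test: "distr M (MX \<Otimes>\<^sub>M MY) (Z (n+1)) = G"
    and Fbar: "Fbar = mixture (MX \<Otimes>\<^sub>M MY) {1..n} (\<lambda>_. 1 / real n) F"
    and \<alpha>: "0 \<le> \<alpha>" "\<alpha> \<le> 1"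
    and w_meas: "w \<in> borel_measurable (MX \<Otimes>\<^sub>M MY)"
    and w_pos: "\<And>p. p \<in> space (MX \<Otimes>\<^sub>M MY) \<Longrightarrow> w p > 0"
    and w_int: "integrable Fbar w"
    and wbar: "\<And>p. wbar p = w p / (\<integral>q. w q \<partial>Fbar)"
  shows "\<P>(\<omega> in M. snd (Z (n+1) \<omega>) \<in> wcp_set MY n s w \<alpha> (\<lambda>i. Z i \<omega>) (fst (Z (n+1) \<omega>)))
    \<ge> 1 - \<alpha> - (1 / real n) *
        (\<Sum>i=1..n. (\<integral>p. max (wstar i p - wbar p) 0 \<partial>F i) + tv_dist (F i) Fbar)"
proof -
  let ?N = "MX \<Otimes>\<^sub>M MY" and ?I = "{1..n+1}"
  interpret training_laws ?N n F using n F_prob F_sets by (rule training_laws.intro)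
  interpret M: prob_space M by (rule M_prob)
  interpret Fb: prob_space Fbar unfolding Fbar by (rule prob_space_average)
  define U where "U = uncovered s w (1 - \<alpha>)"
  define c where "c = (\<integral>q. w q \<partial>Fbar)"
  have sets_Fbar: "sets Fbar = sets ?N" by (simp add: Fbar)
  have space_F: "space (F i) = space ?N" if "i \<in> {1..n}" for i
    by (rule sets_eq_imp_space_eq[OF F_sets[OF that]])

  have "0 < c"
    unfolding c_def using w_int w_pos sets_eq_imp_space_eq[OF sets_Fbar]
    by (intro Fb.expectation_greater[OF w_int]) auto
  have wbar_pos: "0 \<le> wbar p" if "p \<in> space ?N" for p
    using w_pos[OF that] \<open>0 < c\<close> by (simp add: wbar c_def[symmetric])
  have wbar_meas: "wbar \<in> borel_measurable ?N"
    unfolding wbar[abs_def] using w_meas by measurable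
  have wbar_int: "(\<integral>\<^sup>+p. ennreal (wbar p) \<partial>Fbar) = 1"
  proof -
    have "(\<integral>\<^sup>+p. ennreal (wbar p) \<partial>Fbar) = ennreal (\<integral>p. wbar p \<partial>Fbar)"
      using w_int wbar_pos sets_eq_imp_space_eq[OF sets_Fbar]
      by (intro nn_integral_eq_integral) (auto simp: wbar[abs_def])
    also have "(\<integral>p. wbar p \<partial>Fbar) = 1"
      using \<open>0 < c\<close> by (simp add: wbar[abs_def] c_def)
    finally show ?thesis by simp
  qed

  have Z_meas: "Z i \<in> measurable M ?N" if "i \<in> ?I" for i
    using Z_indep that unfolding M.indep_vars_def by blast
  have U_meas: "{z \<in> space data. U (bag n z) (z k)} \<in> sets data" if "k \<in> ?I" for k
    unfolding U_def using w_meas s_meas that by (rule measurable_uncovered)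
  have level: "(\<Sum>k=1..n+1. if U (bag n z) (z k) then ennreal (wbar (z k)) else 0)
      \<le> ennreal \<alpha> * (\<Sum>k=1..n+1. ennreal (wbar (z k)))" if "z \<in> space data" for z
  proof -
    have z: "z k \<in> space ?N" if "k \<in> ?I" for k
      using \<open>z \<in> space data\<close> that by (auto simp: space_PiM)
    have "(\<Sum>k=1..n+1. if U (bag n z) (z k) then w (z k) else 0) \<le> \<alpha> * (\<Sum>k=1..n+1. w (z k))"
      using sum_uncovered_le[of "bag n z" w "1 - \<alpha>" s] w_pos[OF z] \<alpha>
      unfolding sum_bag U_def by (fastforce simp: bag_def intro: less_imp_le)
    then have "(\<Sum>k=1..n+1. if U (bag n z) (z k) then w (z k) else 0) / c
        \<le> (\<alpha> * (\<Sum>k=1..n+1. w (z k))) / c"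
      using \<open>0 < c\<close> by (intro divide_right_mono) auto
    then have "(\<Sum>k=1..n+1. (if U (bag n z) (z k) then w (z k) else 0) / c)
        \<le> \<alpha> * (\<Sum>k=1..n+1. w (z k) / c)"
      by (simp only: sum_divide_distrib[symmetric] times_divide_eq_right)
    also have "(\<Sum>k=1..n+1. (if U (bag n z) (z k) then w (z k) else 0) / c)
        = (\<Sum>k=1..n+1. if U (bag n z) (z k) then wbar (z k) else 0)"
      by (intro sum.cong) (auto simp: wbar c_def)
    also have "(\<Sum>k=1..n+1. w (z k) / c) = (\<Sum>k=1..n+1. wbar (z k))"
      by (simp only: wbar c_def)
    finally have real: "(\<Sum>k=1..n+1. if U (bag n z) (z k) then wbar (z k) else 0)
        \<le> \<alpha> * (\<Sum>k=1..n+1. wbar (z k))" .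
    have "(\<Sum>k=1..n+1. if U (bag n z) (z k) then ennreal (wbar (z k)) else 0)
        = (\<Sum>k=1..n+1. ennreal (if U (bag n z) (z k) then wbar (z k) else 0))"
      by (intro sum.cong) auto
    also have "\<dots> = ennreal (\<Sum>k=1..n+1. if U (bag n z) (z k) then wbar (z k) else 0)"
      using wbar_pos[OF z] by (intro sum_ennreal) auto
    also have "\<dots> \<le> ennreal (\<alpha> * (\<Sum>k=1..n+1. wbar (z k)))"
      using real by (rule ennreal_leI)
    also have "\<dots> = ennreal \<alpha> * (\<Sum>k=1..n+1. ennreal (wbar (z k)))"
      using \<alpha> wbar_pos[OF z] by (subst sum_ennreal) (auto simp: ennreal_mult' simp del: sum.cl_ivl_Suc)
    finally show ?thesis .
  qed

  let ?D = "\<lambda>i. \<integral>p. max (wstar i p - wbar p) 0 \<partial>F i"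
  have D: "(\<integral>\<^sup>+p. ennreal (wstar i p) - ennreal (wbar p) \<partial>F i) = ennreal (?D i)"
    if i: "i \<in> {1..n}" for i
  proof -
    note [measurable] = wstar_meas[OF i] wbar_meas
    note cong = measurable_cong_sets[OF F_sets[OF i] refl]
    have "(\<integral>\<^sup>+p. ennreal (wstar i p) \<partial>F i) = emeasure G (space G)"
      unfolding wstar_density[OF i, symmetric] using wstar_meas[OF i]
      by (subst emeasure_density) (simp_all add: cong cong: nn_integral_cong)
    then have fin: "(\<integral>\<^sup>+p. ennreal (wstar i p) \<partial>F i) < \<infinity>"
      using prob_space.emeasure_space_1[OF G_prob] by simp
    have "(\<integral>\<^sup>+p. ennreal (max (wstar i p - wbar p) 0) \<partial>F i) \<le> (\<integral>\<^sup>+p. ennreal (wstar i p) \<partial>F i)"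
      using wbar_pos wstar_nonneg[OF i] space_F[OF i] by (intro nn_integral_mono ennreal_leI) simp
    then have "integrable (F i) (\<lambda>p. max (wstar i p - wbar p) 0)"
      using fin by (intro integrableI_nonneg) (auto simp: cong)
    then have "(\<integral>\<^sup>+p. ennreal (max (wstar i p - wbar p) 0) \<partial>F i) = ennreal (?D i)"
      by (intro nn_integral_eq_integral) auto
    moreover have "(\<integral>\<^sup>+p. ennreal (wstar i p) - ennreal (wbar p) \<partial>F i)
        = (\<integral>\<^sup>+p. ennreal (max (wstar i p - wbar p) 0) \<partial>F i)"
      using wbar_pos space_F[OF i]
      by (intro nn_integral_cong) (simp add: ennreal_minus max_def ennreal_neg)
    ultimately show ?thesis by simp
  qed

  \<comment> \<open>The dataset as a random element of the product space, with law \<open>with_test_law G\<close>.\<close>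
  define z where "z = (\<lambda>\<omega>. \<lambda>i\<in>?I. Z i \<omega>)"
  have z_meas: "z \<in> measurable M data"
    unfolding z_def using Z_meas by (intro measurable_restrict) auto
  have law: "distr M data z = with_test_law G"
  proof -
    have "distr M data z = (\<Pi>\<^sub>M i\<in>?I. distr M ?N (Z i))"
      unfolding z_def using M.indep_vars_iff_distr_eq_PiM'[of ?I Z "\<lambda>_. ?N"] Z_meas Z_indep by auto
    also have "\<dots> = with_test_law G"
      unfolding with_test_law_def using Z_train Z_test
      by (intro PiM_cong refl) (auto simp: le_Suc_eq)
    finally show ?thesis .
  qed
  let ?miss = "{\<omega> \<in> space M. U (bag n (z \<omega>)) (z \<omega> (n+1))}"
  have miss_vimage: "?miss = z -` {y \<in> space data. U (bag n y) (y (n+1))} \<inter> space M"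
    using measurable_space[OF z_meas] by auto
  have U_test: "{y \<in> space data. U (bag n y) (y (n+1))} \<in> sets data" by (rule U_meas) simp
  have miss_set: "?miss \<in> sets M"
    unfolding miss_vimage using z_meas U_test by (rule measurable_sets)
  have miss: "emeasure (with_test_law G) {y \<in> space data. U (bag n y) (y (n+1))} = ennreal (M.prob ?miss)"
    unfolding law[symmetric] emeasure_distr[OF z_meas U_test]
    by (simp only: miss_vimage[symmetric] M.emeasure_eq_measure)

  have "snd (Z (n+1) \<omega>) \<in> wcp_set MY n s w \<alpha> (\<lambda>i. Z i \<omega>) (fst (Z (n+1) \<omega>))
      \<longleftrightarrow> \<not> U (bag n (z \<omega>)) (z \<omega> (n+1))" if \<omega>: "\<omega> \<in> space M" for \<omega>
  proof -
    have Z_space: "Z i \<omega> \<in> space ?N" if "i \<in> ?I" for i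
      using measurable_space[OF Z_meas[OF that] \<omega>] .
    have "snd (Z (n+1) \<omega>) \<in> space MY"
      using Z_space[of "n+1"] by (auto simp: space_pair_measure)
    moreover have "(\<lambda>i. Z i \<omega>)(n+1 := (fst (Z (n+1) \<omega>), snd (Z (n+1) \<omega>))) = (\<lambda>i. Z i \<omega>)"
      by auto
    moreover have "bag n (z \<omega>) = bag n (\<lambda>i. Z i \<omega>)"
      unfolding bag_def z_def by (intro image_mset_cong) auto
    moreover have "z \<omega> (n+1) = Z (n+1) \<omega>" by (simp add: z_def)
    ultimately show ?thesis
      using score_le_quantile_iff[of n w "\<lambda>i. Z i \<omega>" s "n+1" "1 - \<alpha>"] w_pos[OF Z_space]
      unfolding wcp_set_def U_def Let_def by simp
  qed
  then have "\<P>(\<omega> in M. snd (Z (n+1) \<omega>) \<in> wcp_set MY n s w \<alpha> (\<lambda>i. Z i \<omega>) (fst (Z (n+1) \<omega>)))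
      = M.prob (space M - ?miss)"
    by (intro arg_cong[where f = M.prob]) auto
  also have "\<dots> = 1 - M.prob ?miss" using miss_set by (rule M.prob_compl)
  finally have cover: "\<P>(\<omega> in M. snd (Z (n+1) \<omega>) \<in> wcp_set MY n s w \<alpha> (\<lambda>i. Z i \<omega>) (fst (Z (n+1) \<omega>)))
      = 1 - M.prob ?miss" .

  have tv: "0 \<le> tv_dist (F i) Fbar" if "i \<in> {1..n}" for i
    using F_prob[OF that] Fb.prob_space_axioms by (rule tv_dist_nonneg)
  have D_nonneg: "0 \<le> ?D i" for i by (intro Bochner_Integration.integral_nonneg) simp
  have bound_nonneg: "0 \<le> (\<Sum>i=1..n. ?D i + tv_dist (F i) Fbar)"
    by (intro sum_nonneg add_nonneg_nonneg D_nonneg tv)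
  have "of_nat n * ennreal (M.prob ?miss)
      \<le> of_nat n * ennreal \<alpha>
        + (\<Sum>i=1..n. (\<integral>\<^sup>+p. ennreal (wstar i p) - ennreal (wbar p) \<partial>F i) + ennreal (tv_dist (F i) Fbar))"
    unfolding miss[symmetric] Fbar using wstar_meas wbar_meas wbar_int
    by (intro weighted_rejection_bound G_prob G_sets wstar_density U_meas level)
      (auto simp: Fbar)
  also have "\<dots> = of_nat n * ennreal \<alpha> + (\<Sum>i=1..n. ennreal (?D i + tv_dist (F i) Fbar))"
    using D tv D_nonneg by (intro arg_cong2[where f="(+)"] sum.cong refl) (simp add: ennreal_plus)
  also have "\<dots> = ennreal (real n) * ennreal \<alpha> + ennreal (\<Sum>i=1..n. ?D i + tv_dist (F i) Fbar)"
    using tv D_nonneg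
    by (subst sum_ennreal) (auto simp: ennreal_of_nat_eq_real_of_nat intro!: add_nonneg_nonneg)
  also have "\<dots> = ennreal (real n * \<alpha> + (\<Sum>i=1..n. ?D i + tv_dist (F i) Fbar))"
    using \<alpha> bound_nonneg by (subst ennreal_plus) (auto simp: ennreal_mult')
  finally have "ennreal (real n * M.prob ?miss)
      \<le> ennreal (real n * \<alpha> + (\<Sum>i=1..n. ?D i + tv_dist (F i) Fbar))"
    by (simp only: ennreal_of_nat_eq_real_of_nat ennreal_mult'[OF of_nat_0_le_iff])
  then have "real n * M.prob ?miss \<le> real n * \<alpha> + (\<Sum>i=1..n. ?D i + tv_dist (F i) Fbar)"
    using \<alpha> bound_nonneg by (subst (asm) ennreal_le_iff) auto
  then have "M.prob ?miss \<le> \<alpha> + (1 / real n) * (\<Sum>i=1..n. ?D i + tv_dist (F i) Fbar)"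
    using n by (simp add: field_simps)
  then show ?thesis unfolding cover by simp
qed

end
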